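(* Let $\omega,\omega':[0,\infty)\to[0,\infty)$ be two moduli of continuity such that $$\lim_{h\to 0}\frac{\omega(h)}{h}=\infty,$$ and let $\omega'$ be bounded. Then there exists a function $f:[0,1]\to\mathbb{R}$ of bounded variation such that $\omega_f\le\omega$ and $\omega_{\mathrm{Var}_f}\ge\omega'$ (pointwise on $[0,\infty)$).
   Context: A modulus of continuity is a continuous, increasing function $\omega:[0,\infty)\to[0,\infty)$ with $\omega(0)=0$; "increasing" is meant in the non-strict sense. For $f:[a,b]\to\mathbb{R}$, the variation is $$\mathrm{Var}(f;a,b):=\sup\Big\{\sum_{i=1}^n|f(x_i)-f(x_{i-1})| : a=x_0\le x_1\le\dots\le x_n=b \text{ for some } n\in\mathbb{N}\Big\}.$$ The function $f$ is of bounded variation if $\mathrm{Var}(f;a,b)<\infty$; in that case its variation function is $\mathrm{Var}_f:[a,b]\to\mathbb{R}$, $\mathrm{Var}_f(x):=\mathrm{Var}(f;a,x)$. For an interval $\mathcal{I}\subset\mathbb{R}$ and a continuous function $g:\mathcal{I}\to\mathbb{R}$, the minimal modulus of continuity of $g$ is, for $h\ge 0$, $$\omega_g(h):=\sup\{|g(x)-g(y)| : x,y\in\mathcal{I},\ |x-y|\le h\}.$$ A function $f$ of bounded variation on $[a,b]$ is continuous if and only if $\mathrm{Var}_f$ is continuous. The function $f$ asserted to exist is continuous, so that $\omega_f$ and $\omega_{\mathrm{Var}_f}$ are defined. *)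

theory Defs
  imports "HOL-Analysis.Analysis"
begin

definition modulus_of_continuity :: "(real \<Rightarrow> real) \<Rightarrow> bool" where
  "modulus_of_continuity w \<longleftrightarrow>
     (\<forall>h\<ge>0. 0 \<le> w h) \<and> continuous_on {0..} w \<and> mono_on {0..} w \<and> w 0 = 0"

text \<open>Suprema are taken in the extended reals, since they may be infinite
  for a general function.\<close>

definition variation :: "(real \<Rightarrow> real) \<Rightarrow> real \<Rightarrow> real \<Rightarrow> ereal" where
  "variation f a b =
     Sup {ereal (\<Sum>i=1..n. \<bar>f (x i) - f (x (i - 1))\<bar>) | (n :: nat) (x :: nat \<Rightarrow> real).
            x 0 = a \<and> x n = b \<and> (\<forall>i\<in>{1..n}. x (i - 1) \<le> x i)}"

definition bounded_variation_on :: "(real \<Rightarrow> real) \<Rightarrow> real \<Rightarrow> real \<Rightarrow> bool" where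
  "bounded_variation_on f a b \<longleftrightarrow> variation f a b < \<infinity>"

text \<open>Only meaningful at points of \<open>[a, b]\<close>, for \<open>f\<close> of bounded variation on \<open>[a, b]\<close>.\<close>

definition variation_function :: "(real \<Rightarrow> real) \<Rightarrow> real \<Rightarrow> real \<Rightarrow> real" where
  "variation_function f a x = real_of_ereal (variation f a x)"

definition minimal_modulus :: "real set \<Rightarrow> (real \<Rightarrow> real) \<Rightarrow> real \<Rightarrow> ereal" where
  "minimal_modulus I g h = Sup {ereal \<bar>g x - g y\<bar> | x y. x \<in> I \<and> y \<in> I \<and> \<bar>x - y\<bar> \<le> h}"

end

theory Submission
  imports Defs
begin

text \<open>On disjoint intervals \<open>I\<^sub>k = [2\<^sup>-\<^sup>(\<^sup>k\<^sup>+\<^sup>1\<^sup>), 2\<^sup>-\<^sup>(\<^sup>k\<^sup>+\<^sup>1\<^sup>) + l\<^sub>k]\<close> place a triangular zigzag \<open>g\<^sub>k\<close> of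
  variation \<open>v\<^sub>k = M / 2\<^sup>k\<close>, where \<open>M\<close> bounds \<open>\<omega>'\<close>, and let \<open>f\<close> be the supremum of the \<open>g\<^sub>k\<close>.
  The slope of \<open>g\<^sub>k\<close> is \<open>L = v\<^sub>k / l\<^sub>k\<close>, however many teeth are used. As \<open>\<omega> h / h\<close> tends to infinity,
  \<open>L h \<le> \<omega> h\<close> for small \<open>h\<close>; making the teeth so small that the height of \<open>g\<^sub>k\<close> is below \<open>\<omega> h\<close> for
  all other \<open>h\<close> yields a \<open>g\<^sub>k\<close> with modulus of continuity \<open>\<omega>\<close>, and this passes to the supremum.
  If the lengths \<open>l\<^sub>k\<close> shrink fast enough, each \<open>h\<close> admits a \<open>k\<close> with \<open>l\<^sub>k \<le> h\<close> and
  \<open>\<omega>' h \<le> v\<^sub>k\<close>.\<close>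

section \<open>Upper and lower bounds for the variation\<close>

lemma variation_le:
  assumes "\<And>x y. x \<le> y \<Longrightarrow> \<bar>f x - f y\<bar> \<le> V y - V x"
  shows "variation f a b \<le> ereal (V b - V a)"
  unfolding variation_def
proof (rule Sup_least, clarify)
  fix n and x :: "nat \<Rightarrow> real"
  assume x: "\<forall>i\<in>{1..n}. x (i - 1) \<le> x i" "a = x 0" "b = x n"
  have "(\<Sum>i=1..n. \<bar>f (x i) - f (x (i - 1))\<bar>) \<le> (\<Sum>i=1..n. V (x i) - V (x (i - 1)))"
    using x(1) assms by (intro sum_mono) (metis abs_minus_commute)
  also have "\<dots> = V (x n) - V (x 0)"
    by (induction n) auto
  finally show "ereal (\<Sum>i=1..n. \<bar>f (x i) - f (x (i - 1))\<bar>) \<le> ereal (V (x n) - V (x 0))"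
    by simp
qed

text \<open>Appending \<open>y\<close> to any partition of \<open>[a, b]\<close> gives a partition
  of \<open>[a, c]\<close>. The sum over \<open>y\<close> is a real number, so it can be subtracted
  in \<open>ereal\<close> even if the variations are infinite.\<close>

lemma variation_add_partition_le:
  fixes y :: "nat \<Rightarrow> real"
  assumes y: "y 0 = b" "y m = c" "\<And>i. i \<in> {1..m} \<Longrightarrow> y (i - 1) \<le> y i"
  shows "variation f a b + ereal (\<Sum>i=1..m. \<bar>f (y i) - f (y (i - 1))\<bar>) \<le> variation f a c"
    (is "_ + ereal ?T \<le> _")
proof -
  have "variation f a b \<le> variation f a c - ereal ?T"
    unfolding variation_def[of f a b]
  proof (rule Sup_least, clarify)
    fix n and x :: "nat \<Rightarrow> real"
    assume x: "\<forall>i\<in>{1..n}. x (i - 1) \<le> x i" "a = x 0" "b = x n"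
    let ?S = "\<Sum>i=1..n. \<bar>f (x i) - f (x (i - 1))\<bar>"
    define z where "z i = (if i \<le> n then x i else y (i - n))" for i
    have zl: "z i = x i" if "i \<le> n" for i
      using that by (simp add: z_def)
    \<comment> \<open>At \<open>i = 0\<close> the first branch of \<open>z\<close> applies; the
      branches agree there since \<open>x n = b = y 0\<close>.\<close>
    have zr: "z (i + n) = y i" for i
      using x y(1) by (auto simp: z_def)
    have zr': "z (i + n - 1) = y (i - 1)" if "i \<ge> 1" for i
      using zr[of "i - 1"] that by simp
    have mono: "z (i - 1) \<le> z i" if i: "i \<in> {1..n + m}" for i
    proof (cases "i \<le> n")
      case True
      then show ?thesis using x(1) i by (auto simp: zl)
    next
      case False
      then show ?thesis
        using zr[of "i - n"] zr'[of "i - n"] y(3)[of "i - n"] i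
        by (simp add: Suc_le_eq le_diff_conv)
    qed
    have "(\<Sum>i=1..n + m. \<bar>f (z i) - f (z (i - 1))\<bar>)
        = (\<Sum>i=1..n. \<bar>f (z i) - f (z (i - 1))\<bar>) + (\<Sum>i=n+1..n + m. \<bar>f (z i) - f (z (i - 1))\<bar>)"
      by (rule sum.ub_add_nat) simp
    also have "(\<Sum>i=1..n. \<bar>f (z i) - f (z (i - 1))\<bar>) = ?S"
      by (intro sum.cong) (auto simp: zl)
    also have "(\<Sum>i=n+1..n + m. \<bar>f (z i) - f (z (i - 1))\<bar>)
        = (\<Sum>i=1..m. \<bar>f (z (i + n)) - f (z (i + n - 1))\<bar>)"
      using sum.shift_bounds_cl_nat_ivl[of "\<lambda>i. \<bar>f (z i) - f (z (i - 1))\<bar>" 1 n m]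
      by (simp add: add.commute)
    also have "\<dots> = ?T"
      using zr' by (intro sum.cong) (auto simp: zr)
    finally have "(\<Sum>i=1..n + m. \<bar>f (z i) - f (z (i - 1))\<bar>) = ?S + ?T" .
    moreover have "z 0 = x 0" "z (n + m) = c"
      using zl[of 0] zr[of m] y(2) by (auto simp: add.commute)
    ultimately have "ereal (?S + ?T) \<le> variation f (x 0) c"
      unfolding variation_def using mono
      by (intro Sup_upper CollectI exI[of _ "n + m"] exI[of _ z]) auto
    then show "ereal ?S \<le> variation f (x 0) c - ereal ?T"
      by (simp add: ereal_le_minus_iff)
  qed
  then show ?thesis
    by (simp add: ereal_le_minus_iff)
qed

section \<open>The triangle wave and zigzags of prescribed variation\<close>

definition dist_int :: "real \<Rightarrow> real" where
  "dist_int x = \<bar>x - of_int (round x)\<bar>"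

text \<open>The integer nearest to \<open>u\<close> is at least as close to \<open>u\<close> as
  \<open>round w\<close> is; the triangle inequality does the rest.\<close>

lemma dist_int_lipschitz: "\<bar>dist_int x - dist_int y\<bar> \<le> \<bar>x - y\<bar>"
proof -
  have "dist_int u - dist_int w \<le> \<bar>u - w\<bar>" for u w
    using round_diff_minimal[of u "round w"] unfolding dist_int_def by linarith
  from this[of x y] this[of y x] show ?thesis by linarith
qed

lemma dist_int_bounds: "0 \<le> dist_int x" "dist_int x \<le> 1"
  using of_int_round_abs_le[of x] unfolding dist_int_def by linarith+

lemma dist_int_of_nat [simp]: "dist_int (of_nat n) = 0"
  by (simp add: dist_int_def)

text \<open>These points are zeros and peaks of the wave, so a partition through them captures its
  full variation.\<close>

lemma dist_int_half_nat: "dist_int (real i / 2) = (if even i then 0 else 1 / 2)"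
proof (cases "even i")
  case True
  then obtain j where "i = 2 * j" by blast
  then show ?thesis by simp
next
  case False
  then obtain j where j: "i = 2 * j + 1" by (blast elim: oddE)
  then have "real i / 2 = of_int (int j) + 1 / 2" by simp
  moreover have "round (of_int (int j) + 1 / 2 :: real) = int j + 1"
    unfolding round_def by linarith
  ultimately have "dist_int (real i / 2) = \<bar>of_int (int j) + 1 / 2 - of_int (int j + 1)\<bar>"
    by (simp only: dist_int_def)
  then show ?thesis using False by simp
qed

lemma clamp_diff_le: "\<bar>max a (min b x) - max a (min b y)\<bar> \<le> \<bar>x - (y::real)\<bar>"
  by linarith

text \<open>Clamping to \<open>[a, b]\<close> counts only the distance travelled inside the
  interval, so that slope bounds on different intervals can be summed. The partition in the last
  clause attains the variation \<open>v\<close>, which the slope bound shows to be maximal.\<close>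

definition zigzag :: "(real \<Rightarrow> real) \<Rightarrow> real \<Rightarrow> real \<Rightarrow> real \<Rightarrow> (real \<Rightarrow> real) \<Rightarrow> bool" where
  "zigzag w a b v g \<longleftrightarrow>
    (\<forall>x. 0 \<le> g x \<and> g x \<le> v) \<and> (\<forall>x. x \<le> a \<or> b \<le> x \<longrightarrow> g x = 0) \<and>
    (\<forall>x y. \<bar>g x - g y\<bar> \<le> w \<bar>x - y\<bar>) \<and>
    (\<forall>x y. \<bar>g x - g y\<bar> \<le> v / (b - a) * \<bar>max a (min b x) - max a (min b y)\<bar>) \<and>
    (\<exists>(n :: nat) p. p 0 = a \<and> p n = b \<and> (\<forall>i\<in>{1..n}. p (i - 1) \<le> p i) \<and> (\<forall>i\<le>n. a \<le> p i \<and> p i \<le> b) \<and>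
      (\<Sum>i=1..n. \<bar>g (p i) - g (p (i - 1))\<bar>) = v)"

text \<open>The \<open>n\<close> teeth of height \<open>v / (2 * n)\<close> have total variation
  \<open>v\<close> and slope \<open>v / (b - a)\<close>, whatever \<open>n\<close> is. The slope
  handles distances up to \<open>d\<close>, the height all larger ones.\<close>

lemma zigzag_exists:
  assumes mono: "mono_on {0..} w" and nonneg: "\<And>h. h \<ge> 0 \<Longrightarrow> 0 \<le> w h"
    and lim: "filterlim (\<lambda>h. w h / h) at_top (at_right 0)"
    and ab: "a < b" and v: "0 < v"
  obtains g where "zigzag w a b v g"
proof -
  define L where "L = v / (b - a)"
  have L: "L > 0" using ab v by (simp add: L_def)
  have "eventually (\<lambda>h. w h / h \<ge> L) (at_right 0)"
    using lim by (simp add: filterlim_at_top)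
  then obtain e where e: "e > 0" "\<And>h. 0 < h \<Longrightarrow> h < e \<Longrightarrow> w h / h \<ge> L"
    by (auto simp: eventually_at_right_field)
  \<comment> \<open>Halving turns the open range \<open>h < e\<close> into a closed one.\<close>
  define d where "d = e / 2"
  have d: "d > 0" using e by (simp add: d_def)
  have small: "L * h \<le> w h" if "0 \<le> h" "h \<le> d" for h
    using that e(2)[of h] e(1) nonneg[of 0] by (cases "h = 0") (auto simp: d_def field_simps)
  have wd: "w d > 0"
    using small[of d] d L by (meson less_le_trans less_imp_le mult_pos_pos order_refl)
  \<comment> \<open>Enough teeth to push their height below \<open>w d\<close>.\<close>
  obtain n where n: "real n > v / w d"
    using reals_Archimedean2 by blast
  have npos: "real n > 0"
    using n v wd by (meson divide_pos_pos less_trans)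
  define s where "s = v / n"
  have s: "s > 0" "s \<le> w d" "s \<le> v"
    using n npos v wd by (auto simp: s_def field_simps)
  define c where "c x = max a (min b x)" for x
  define g where "g x = s * dist_int (n * (c x - a) / (b - a))" for x
  have g_bounds: "0 \<le> g x" "g x \<le> s" for x
    using dist_int_bounds[of "n * (c x - a) / (b - a)"] s(1)
    by (auto simp: g_def mult_left_le)
  have g_zero: "g x = 0" if "x \<le> a \<or> b \<le> x" for x
  proof -
    \<comment> \<open>At both ends the argument of \<open>dist_int\<close> is an integer, 0 or
      \<open>n\<close>.\<close>
    have "c x = a \<or> c x = b" using that ab by (auto simp: c_def)
    then show ?thesis using ab dist_int_of_nat[of 0] by (auto simp: g_def)
  qed
  have lip: "\<bar>g x - g y\<bar> \<le> L * \<bar>c x - c y\<bar>" for x y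
  proof -
    have "\<bar>g x - g y\<bar> = s * \<bar>dist_int (n * (c x - a) / (b - a)) - dist_int (n * (c y - a) / (b - a))\<bar>"
      using s(1) by (simp add: g_def abs_mult flip: right_diff_distrib)
    also have "\<dots> \<le> s * \<bar>n * (c x - a) / (b - a) - n * (c y - a) / (b - a)\<bar>"
      using s(1) by (intro mult_left_mono dist_int_lipschitz) auto
    also have "n * (c x - a) / (b - a) - n * (c y - a) / (b - a) = n / (b - a) * (c x - c y)"
      by (simp add: algebra_simps diff_divide_distrib)
    also have "s * \<bar>n / (b - a) * (c x - c y)\<bar> = L * \<bar>c x - c y\<bar>"
      using ab npos by (simp add: abs_mult L_def s_def)
    finally show ?thesis .
  qed
  have modulus: "\<bar>g x - g y\<bar> \<le> w \<bar>x - y\<bar>" for x y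
  proof (cases "\<bar>x - y\<bar> \<le> d")
    case True
    have "\<bar>g x - g y\<bar> \<le> L * \<bar>x - y\<bar>"
      using lip[of x y] clamp_diff_le[of a b x y] L
      by (smt (verit) c_def mult_left_mono)
    then show ?thesis using small[of "\<bar>x - y\<bar>"] True by simp
  next
    case False
    then have "w d \<le> w \<bar>x - y\<bar>" using d by (intro mono_onD[OF mono]) auto
    then show ?thesis using g_bounds[of x] g_bounds[of y] s by linarith
  qed
  \<comment> \<open>Steps of half a tooth: even indices hit zeros, odd ones peaks, so each of the
    \<open>2 * n\<close> steps contributes \<open>s / 2\<close>.\<close>
  define p where "p i = a + real i * (b - a) / (2 * n)" for i :: nat
  have p_le: "p i \<le> p j" if "i \<le> j" for i j
    using that ab npos by (simp add: p_def divide_right_mono mult_right_mono)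
  have p_ends: "p 0 = a" "p (2 * n) = b"
    using npos by (auto simp: p_def)
  have p_in: "a \<le> p i \<and> p i \<le> b" if "i \<le> 2 * n" for i
    using p_le[of 0 i] p_le[of i "2 * n"] that p_ends by simp
  have g_p: "g (p i) = s * (if even i then 0 else 1 / 2)" if "i \<le> 2 * n" for i
  proof -
    have "c (p i) = p i" using p_in[OF that] by (simp add: c_def)
    then have "n * (c (p i) - a) / (b - a) = real i / 2"
      using ab npos by (simp add: p_def divide_eq_eq)
    then show ?thesis by (simp only: g_def dist_int_half_nat)
  qed
  have "(\<Sum>i=1..2*n. \<bar>g (p i) - g (p (i - 1))\<bar>) = (\<Sum>i=1..2*n. s / 2)"
  proof (rule sum.cong[OF refl])
    fix i assume "i \<in> {1..2*n}"
    then show "\<bar>g (p i) - g (p (i - 1))\<bar> = s / 2"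
      using g_p[of i] g_p[of "i - 1"] s(1) le_diff_conv[of i 1 "2 * n"] by (cases "even i") auto
  qed
  also have "\<dots> = v" using npos by (simp add: s_def)
  finally have sum: "(\<Sum>i=1..2*n. \<bar>g (p i) - g (p (i - 1))\<bar>) = v" .
  have "\<exists>(n :: nat) p. p 0 = a \<and> p n = b \<and> (\<forall>i\<in>{1..n}. p (i - 1) \<le> p i) \<and> (\<forall>i\<le>n. a \<le> p i \<and> p i \<le> b) \<and>
      (\<Sum>i=1..n. \<bar>g (p i) - g (p (i - 1))\<bar>) = v"
    using p_ends p_in p_le sum by (intro exI[of _ "2 * n"] exI[of _ p]) auto
  moreover have "\<forall>x. 0 \<le> g x \<and> g x \<le> v"
    using g_bounds s(3) by (meson order_trans)
  ultimately have "zigzag w a b v g"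
    unfolding zigzag_def using g_zero modulus lip unfolding L_def c_def by blast
  then show ?thesis by (rule that)
qed

theorem theorem6:
  fixes \<omega> \<omega>' :: "real \<Rightarrow> real"
  assumes "modulus_of_continuity \<omega>"
    and "modulus_of_continuity \<omega>'"
    and "filterlim (\<lambda>h. \<omega> h / h) at_top (at_right 0)"
    and "bounded (\<omega>' ` {0..})"
  shows "\<exists>f :: real \<Rightarrow> real.
           continuous_on {0..1} f \<and>
           bounded_variation_on f 0 1 \<and>
           (\<forall>h\<ge>0. minimal_modulus {0..1} f h \<le> ereal (\<omega> h)) \<and>
           (\<forall>h\<ge>0. minimal_modulus {0..1} (variation_function f 0) h \<ge> ereal (\<omega>' h))"
proof -
  have w: "mono_on {0..} \<omega>" "\<And>h. h \<ge> 0 \<Longrightarrow> 0 \<le> \<omega> h" "continuous_on {0..} \<omega>" "\<omega> 0 = 0"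
    and w': "mono_on {0..} \<omega>'" "continuous_on {0..} \<omega>'" "\<omega>' 0 = 0"
    using assms(1,2) by (auto simp: modulus_of_continuity_def)
  \<comment> \<open>Serves \<open>\<omega>'\<close> in the choice of \<open>r\<close> and
    \<open>\<omega>\<close> in the continuity of \<open>f\<close>.\<close>
  have near_0: "\<exists>d>0. \<forall>h. 0 \<le> h \<and> h \<le> d \<longrightarrow> u h < e"
    if u: "continuous_on {0..} u" "u 0 = 0" and e: "e > 0" for u :: "real \<Rightarrow> real" and e
  proof -
    obtain d where d: "d > 0" "\<And>h. h \<in> {0..} \<Longrightarrow> dist h 0 < d \<Longrightarrow> dist (u h) (u 0) < e"
      using u(1) e unfolding continuous_on_iff by (metis atLeast_iff order_refl)
    then show ?thesis
      using u(2) by (intro exI[of _ "d / 2"]) (auto simp: dist_real_def abs_less_iff)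
  qed

  \<comment> \<open>Choice of the blocks and their zigzags\<close>
  obtain M where M: "M > 0" "\<And>h. h \<ge> 0 \<Longrightarrow> \<omega>' h \<le> M"
    using assms(4) unfolding bounded_pos by (auto simp: abs_le_iff)
  define v where "v k = M / 2 ^ k" for k :: nat
  have v: "v k > 0" "v k \<le> M" for k
    using M(1) by (auto simp: v_def field_simps)
  \<comment> \<open>The first bound keeps the blocks disjoint up to end points and makes
    \<open>r\<close> tend to 0; the second lets variation \<open>v k\<close> suffice for all
    \<open>h\<close> up to \<open>r k\<close>.\<close>
  have "\<exists>r>0. r \<le> 1 / 2 ^ k \<and> \<omega>' r \<le> v k" for k
  proof -
    obtain d where d: "d > 0" "\<forall>h. 0 \<le> h \<and> h \<le> d \<longrightarrow> \<omega>' h < v k"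
      using near_0[OF w'(2,3) v(1)] by blast
    then show ?thesis
      by (intro exI[of _ "min d (1 / 2 ^ k)"]) (auto intro: less_imp_le)
  qed
  then obtain r where r: "\<And>k. r k > 0" "\<And>k. r k \<le> 1 / 2 ^ k" "\<And>k. \<omega>' (r k) \<le> v k"
    by metis
  define a where "a k = (1 / 2 ^ Suc k :: real)" for k
  \<comment> \<open>The shifted index matters: a block of length \<open>r (Suc k)\<close> has to
    serve \<open>h\<close> from \<open>r (Suc k)\<close> up to \<open>r k\<close>.\<close>
  define b where "b k = a k + r (Suc k)" for k
  have a_pos: "0 < a k" and ab: "a k < b k" for k
    using r(1) by (auto simp: a_def b_def)
  have b_le: "b k \<le> 1 / 2 ^ k" for k
    using r(2)[of "Suc k"] by (simp add: a_def b_def)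
  have b_le_1: "b k \<le> 1" for k
    using b_le[of k] by (rule order_trans) (simp add: field_simps)
  have order: "b k \<le> a j" if "j < k" for j k
  proof -
    have "(2::real) ^ Suc j \<le> 2 ^ k" using that by (intro power_increasing) auto
    then have "1 / 2 ^ k \<le> a j" unfolding a_def by (intro divide_left_mono) auto
    then show ?thesis using b_le[of k] by linarith
  qed
  define c where "c k x = max (a k) (min (b k) x)" for k and x :: real

  have "\<forall>k. \<exists>g. zigzag \<omega> (a k) (b k) (v k) g"
    using zigzag_exists[OF w(1,2) assms(3) ab v(1)] by metis
  then obtain g where g: "\<And>k. zigzag \<omega> (a k) (b k) (v k) (g k)"
    by metis
  note g' = g[unfolded zigzag_def, folded c_def]
  have g_bounds: "0 \<le> g k x" "g k x \<le> v k" for k x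
    using g'[of k] by simp_all
  have g_zero: "g k x = 0" if "x \<le> a k \<or> b k \<le> x" for k x
    using g'[of k] that by blast
  have g_modulus: "\<bar>g k x - g k y\<bar> \<le> \<omega> \<bar>x - y\<bar>" for k x y
    using g'[of k] by simp
  have g_lip: "\<bar>g k x - g k y\<bar> \<le> v k / (b k - a k) * \<bar>c k x - c k y\<bar>" for k x y
    using g'[of k] by simp
  have g_partition: "\<exists>(n :: nat) p. p 0 = a k \<and> p n = b k \<and> (\<forall>i\<in>{1..n}. p (i - 1) \<le> p i) \<and>
      (\<forall>i\<le>n. a k \<le> p i \<and> p i \<le> b k) \<and> (\<Sum>i=1..n. \<bar>g k (p i) - g k (p (i - 1))\<bar>) = v k" for k
    using g'[of k] by (elim conjE)

  \<comment> \<open>The supremum of the zigzags and its modulus of continuity\<close>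
  define f where "f x = (SUP k. g k x)" for x
  have bdd: "bdd_above (range (\<lambda>k. g k x))" for x
    using g_bounds(2) v(2) by (intro bdd_aboveI[of _ M]) (auto intro: order_trans)
  have g_le_f: "g k x \<le> f x" for k x
    unfolding f_def by (intro cSUP_upper bdd) simp
  \<comment> \<open>A common bound passes to the supremum with the same constant, wherever
    \<open>x\<close> and \<open>y\<close> lie. It is applied with \<open>\<omega>\<close> and with
    increments of \<open>V\<close>.\<close>
  have f_diff: "\<bar>f x - f y\<bar> \<le> D" if D: "\<And>k. \<bar>g k x - g k y\<bar> \<le> D" for x y D
  proof -
    have "g k x \<le> f y + D" "g k y \<le> f x + D" for k
      using D[of k] g_le_f[of k x] g_le_f[of k y] by linarith+
    then have "f x \<le> f y + D" "f y \<le> f x + D"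
      by (subst f_def, intro cSUP_least, auto)+
    then show ?thesis by linarith
  qed
  have f_eq_g: "f x = g k x" if x: "a k \<le> x" "x \<le> b k" for k x
  proof (rule antisym[OF _ g_le_f])
    \<comment> \<open>The other zigzags vanish at \<open>x\<close>, even where blocks touch, as they
      are 0 at their end points.\<close>
    have "g j x \<le> g k x" for j
    proof (cases j k rule: linorder_cases)
      case less
      then show ?thesis using order[of j k] x g_zero[of x j] g_bounds(1)[of k x] by simp
    next
      case greater
      then show ?thesis using order[of k j] x g_zero[of x j] g_bounds(1)[of k x] by simp
    qed simp
    then show "f x \<le> g k x" unfolding f_def by (intro cSUP_least) auto
  qed

  have f_modulus: "\<bar>f x - f y\<bar> \<le> \<omega> \<bar>x - y\<bar>" for x y
    by (rule f_diff[OF g_modulus])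
  have cont: "continuous_on {0..1} f"
    unfolding continuous_on_iff
  proof clarify
    fix x e :: real assume "e > 0"
    from near_0[OF w(3,4) this] obtain d
      where "d > 0" "\<forall>h. 0 \<le> h \<and> h \<le> d \<longrightarrow> \<omega> h < e" by blast
    then show "\<exists>d>0. \<forall>y\<in>{0..1}. dist y x < d \<longrightarrow> dist (f y) (f x) < e"
      using f_modulus unfolding dist_real_def by (intro exI[of _ d]) (smt (verit))
  qed
  have min_modulus: "minimal_modulus {0..1} f h \<le> ereal (\<omega> h)" if "h \<ge> 0" for h
    unfolding minimal_modulus_def
  proof (rule Sup_least, clarify)
    fix x y :: real assume "\<bar>x - y\<bar> \<le> h"
    then have "\<omega> \<bar>x - y\<bar> \<le> \<omega> h" using that by (intro mono_onD[OF w(1)]) auto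
    then show "ereal \<bar>f x - f y\<bar> \<le> ereal (\<omega> h)" using f_modulus[of x y] by simp
  qed

  \<comment> \<open>Bounded variation by means of a series of linear ramps\<close>
  define V where "V x = (\<Sum>k. v k / (b k - a k) * (c k x - a k))" for x
  \<comment> \<open>The \<open>k\<close>-th ramp rises from 0 to \<open>v k\<close> across its
    block, so the geometric series \<open>v\<close> dominates.\<close>
  have summable: "summable (\<lambda>k. v k / (b k - a k) * (c k x - a k))" for x
  proof (rule summable_comparison_test')
    have "summable (\<lambda>k. M * (1 / 2) ^ k)"
      by (intro summable_mult summable_geometric) simp
    then show "summable v" by (simp add: v_def[abs_def] power_one_over)
    fix k :: nat
    have "0 \<le> c k x - a k" "c k x - a k \<le> b k - a k" using ab[of k] by (auto simp: c_def)
    then have "0 \<le> v k / (b k - a k) * (c k x - a k)"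
      "v k / (b k - a k) * (c k x - a k) \<le> v k / (b k - a k) * (b k - a k)"
      using ab[of k] v(1)[of k] by (auto intro!: mult_left_mono simp del: times_divide_eq_left)
    then show "norm (v k / (b k - a k) * (c k x - a k)) \<le> v k"
      using ab[of k] by simp
  qed
  have V_dominates: "\<bar>f x - f y\<bar> \<le> V y - V x" if xy: "x \<le> y" for x y
  proof (rule f_diff)
    fix k
    let ?t = "\<lambda>k. v k / (b k - a k) * (c k y - a k) - v k / (b k - a k) * (c k x - a k)"
    have t: "?t k = v k / (b k - a k) * \<bar>c k x - c k y\<bar>" for k
    proof -
      have "\<bar>c k x - c k y\<bar> = (c k y - a k) - (c k x - a k)"
        using xy by (auto simp: c_def)
      then show ?thesis by (simp only: right_diff_distrib)
    qed
    \<comment> \<open>All ramps increase, so the increment of a single one is at most that of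
      \<open>V\<close>.\<close>
    have "0 \<le> ?t k" for k
      unfolding t using ab[of k] v(1)[of k] by simp
    then have "?t k \<le> suminf ?t"
      using sum_le_suminf[OF summable_diff[OF summable summable], of "{k}" y x] by simp
    also have "\<dots> = V y - V x"
      unfolding V_def by (rule suminf_diff[symmetric]) (rule summable)+
    finally show "\<bar>g k x - g k y\<bar> \<le> V y - V x"
      using g_lip[of k x y] t[of k] by simp
  qed
  have var_le: "variation f 0 x \<le> ereal (V x - V 0)" for x
    by (rule variation_le[OF V_dominates])
  have bv: "bounded_variation_on f 0 1"
    unfolding bounded_variation_on_def using var_le[of 1] by (rule le_less_trans) simp
  have var_fin: "variation f 0 x = ereal (variation_function f 0 x)" if "x \<ge> 0" for x
  proof -
    \<comment> \<open>A one-step partition excludes the value minus infinity and \<open>V\<close>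
      excludes infinity, so \<open>real_of_ereal\<close> does not fall back on its default
      0.\<close>
    have "ereal \<bar>f x - f 0\<bar> \<le> variation f 0 x"
      unfolding variation_def using that
      by (intro Sup_upper CollectI exI[of _ 1] exI[of _ "\<lambda>i. if i = 0 then 0 else x"]) auto
    then have "\<bar>variation f 0 x\<bar> \<noteq> \<infinity>" using var_le[of x] by auto
    then show ?thesis by (simp add: variation_function_def ereal_real)
  qed

  \<comment> \<open>Lower bound for the modulus of the variation function\<close>
  have var_block: "variation_function f 0 (b k) - variation_function f 0 (a k) \<ge> v k" for k
  proof -
    obtain n :: nat and p where p: "p 0 = a k" "p n = b k" "\<forall>i\<in>{1..n}. p (i - 1) \<le> p i"
      "\<forall>i\<le>n. a k \<le> p i \<and> p i \<le> b k" "(\<Sum>i=1..n. \<bar>g k (p i) - g k (p (i - 1))\<bar>) = v k"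
      using g_partition by blast
    have "(\<Sum>i=1..n. \<bar>f (p i) - f (p (i - 1))\<bar>) = v k"
      unfolding p(5)[symmetric]
    proof (rule sum.cong[OF refl])
      fix i assume "i \<in> {1..n}"
      then have "i \<le> n" "i - 1 \<le> n" by auto
      then have "f (p i) = g k (p i)" "f (p (i - 1)) = g k (p (i - 1))"
        using p(4) f_eq_g by blast+
      then show "\<bar>f (p i) - f (p (i - 1))\<bar> = \<bar>g k (p i) - g k (p (i - 1))\<bar>" by simp
    qed
    then have "variation f 0 (a k) + ereal (v k) \<le> variation f 0 (b k)"
      using variation_add_partition_le[of p "a k" n "b k" f 0] p(1-3) by auto
    then show ?thesis
      using var_fin[of "a k"] var_fin[of "b k"] a_pos[of k] ab[of k] by simp
  qed
  have "minimal_modulus {0..1} (variation_function f 0) h \<ge> ereal (\<omega>' h)" if h: "h \<ge> 0" for h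
  proof (cases "h = 0")
    case True
    \<comment> \<open>No block has length 0, but \<open>\<omega>' 0 = 0\<close>.\<close>
    have "ereal \<bar>variation_function f 0 0 - variation_function f 0 0\<bar>
        \<le> minimal_modulus {0..1} (variation_function f 0) h"
      unfolding minimal_modulus_def using h
      by (intro Sup_upper CollectI exI[of _ 0]) auto
    then show ?thesis using True w'(3) by (simp add: zero_ereal_def)
  next
    case False
    have "\<exists>k. r (Suc k) \<le> h"
    proof -
      obtain k where "(1 / 2) ^ k < h"
        using real_arch_pow_inv[of h "1 / 2"] h False by auto
      moreover have "r (Suc k) \<le> (1 / 2) ^ k"
        using r(2)[of "Suc k"] by (rule order_trans) (simp add: power_one_over field_simps)
      ultimately show ?thesis by (intro exI[of _ k]) linarith
    qed
    \<comment> \<open>\<open>r\<close> need not be monotone; for the least such \<open>k\<close>,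
      either \<open>k = 0\<close> or \<open>h < r k\<close>.\<close>
    then obtain k where k: "r (Suc k) \<le> h" "\<And>j. j < k \<Longrightarrow> \<not> r (Suc j) \<le> h"
      unfolding exists_least_iff[of "\<lambda>k. r (Suc k) \<le> h"] by blast
    have "\<omega>' h \<le> v k"
    proof (cases k)
      case 0
      \<comment> \<open>No upper bound on \<open>h\<close> is available here, which is why
        \<open>v\<close> starts at \<open>M\<close>.\<close>
      then show ?thesis using M(2)[OF h] by (simp add: v_def)
    next
      case (Suc j)
      then have "\<omega>' h \<le> \<omega>' (r k)" using k(2)[of j] h by (intro mono_onD[OF w'(1)]) auto
      then show ?thesis using r(3)[of k] by linarith
    qed
    then have "ereal (\<omega>' h) \<le> ereal \<bar>variation_function f 0 (b k) - variation_function f 0 (a k)\<bar>"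
      using var_block[of k] by simp
    also have "\<dots> \<le> minimal_modulus {0..1} (variation_function f 0) h"
      unfolding minimal_modulus_def
      using a_pos[of k] ab[of k] b_le_1[of k] k(1)
      by (intro Sup_upper CollectI exI[of _ "b k"] exI[of _ "a k"]) (auto simp: b_def)
    finally show ?thesis .
  qed
  then show ?thesis
    using cont bv min_modulus by (intro exI[of _ f]) blast
qed

end
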